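(* Let $D$ be any digraph and let $U\subseteq V(D)$ be any vertex set. If $T\subseteq D$ is a normal arborescence in $D$ with $U\subseteq V(T)$, then $T$ is end-faithful for the set of ends of $D$ in the closure of $U$. That is, every end of $D$ that lies in the closure of $U$ is represented by exactly one ray of $T$ whose first vertex is the root of $T$.
   Context: Digraphs have no loops and no multiple edges, but may have two oppositely directed edges between two vertices. Paths and rays are directed. A ray is an infinite directed path with a first vertex and no last vertex; its subrays are its tails. An arborescence is a rooted oriented tree $T$ that contains, for every vertex $v$, a directed path from the root to $v$. We write $v\le_T w$ if $T$ contains a directed path from $v$ to $w$, and $\lfloor v\rfloor_T=\{w : v\le_T w\}$ for the up-closure of $v$. For an arborescence $T\subseteq D$, a $T$-path is a non-trivial directed path in $D$ that meets $T$ exactly in its endvertices. The normal assistant of $T$ in $D$ is the digraph $H$ obtained from $T$ by adding an edge $vw$ for every two $\le_T$-incomparable $v,w\in V(T)$ for which $D$ has a $T$-path from $\lfloor v\rfloor_T$ to $\lfloor w\rfloor_T$ (whether or not $vw\in E(D)$). $T$ is normal in $D$ if $H$ is acyclic. A ray is solid in $D$ if for every finite $X\subseteq V(D)$ it has a tail in some strong component of $D-X$. Two solid rays are equivalent if for every finite $X$ they have tails in the same strong component of $D-X$. The ends of $D$ are the equivalence classes, and a solid ray represents the end containing it. For an end $\omega$ and finite $X$, $C(X,\omega)$ is the strong component of $D-X$ containing tails of the rays in $\omega$. An end $\omega$ lies in the closure of $U\subseteq V(D)$ if $C(X,\omega)$ meets $U$ for every finite $X\subseteq V(D)$. *)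

theory Defs
  imports "Graph_Theory.Kuratowski"
begin

section \<open>Rays and ends of digraphs\<close>

text \<open>A ray is represented by its unique enumeration starting at its first vertex;
  the tails of a ray \<open>f\<close> are the shifted enumerations \<open>\<lambda>i. f (k + i)\<close>.\<close>

definition ray :: "('a,'b) pre_digraph \<Rightarrow> (nat \<Rightarrow> 'a) \<Rightarrow> bool" where
  "ray G f \<longleftrightarrow> inj f \<and> range f \<subseteq> verts G \<and> (\<forall>i. f i \<rightarrow>\<^bsub>G\<^esub> f (Suc i))"

definition has_tail_in :: "(nat \<Rightarrow> 'a) \<Rightarrow> ('a,'b) pre_digraph \<Rightarrow> bool" where
  "has_tail_in f C \<longleftrightarrow> (\<exists>k. ray C (\<lambda>i. f (k + i)))"

definition minus_verts :: "('a,'b) pre_digraph \<Rightarrow> 'a set \<Rightarrow> ('a,'b) pre_digraph" where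
  "minus_verts G X = G \<restriction> (verts G - X)"

abbreviation sccs_minus :: "('a,'b) pre_digraph \<Rightarrow> 'a set \<Rightarrow> ('a,'b) pre_digraph set" where
  "sccs_minus G X \<equiv> pre_digraph.sccs (minus_verts G X)"

definition solid :: "('a,'b) pre_digraph \<Rightarrow> (nat \<Rightarrow> 'a) \<Rightarrow> bool" where
  "solid G f \<longleftrightarrow> ray G f \<and>
     (\<forall>X. finite X \<and> X \<subseteq> verts G \<longrightarrow> (\<exists>C \<in> sccs_minus G X. has_tail_in f C))"

definition ray_equiv :: "('a,'b) pre_digraph \<Rightarrow> ((nat \<Rightarrow> 'a) \<times> (nat \<Rightarrow> 'a)) set" where
  "ray_equiv G = {(f, g). solid G f \<and> solid G g \<and>
     (\<forall>X. finite X \<and> X \<subseteq> verts G \<longrightarrow>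
        (\<exists>C \<in> sccs_minus G X. has_tail_in f C \<and> has_tail_in g C))}"

definition ends :: "('a,'b) pre_digraph \<Rightarrow> (nat \<Rightarrow> 'a) set set" where
  "ends G = {f. solid G f} // ray_equiv G"

text \<open>This is \<open>C(X,\<omega>)\<close>; it is only meaningful for ends \<open>\<omega>\<close> and finite \<open>X\<close>, see
  \<open>end_component_unique\<close> below.\<close>

definition end_component ::
    "('a,'b) pre_digraph \<Rightarrow> 'a set \<Rightarrow> (nat \<Rightarrow> 'a) set \<Rightarrow> ('a,'b) pre_digraph" where
  "end_component G X \<omega> = (THE C. C \<in> sccs_minus G X \<and> (\<forall>f \<in> \<omega>. has_tail_in f C))"

definition in_closure :: "('a,'b) pre_digraph \<Rightarrow> (nat \<Rightarrow> 'a) set \<Rightarrow> 'a set \<Rightarrow> bool" where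
  "in_closure G \<omega> U \<longleftrightarrow>
     (\<forall>X. finite X \<and> X \<subseteq> verts G \<longrightarrow> verts (end_component G X \<omega>) \<inter> U \<noteq> {})"


subsection \<open>Well-definedness of ends and their components\<close>

lemma has_tail_in_unique:
  assumes "wf_digraph G" "C \<in> sccs_minus G X" "C' \<in> sccs_minus G X"
    and "has_tail_in f C" "has_tail_in f C'"
  shows "C = C'"
proof -
  interpret H: wf_digraph "minus_verts G X"
    unfolding minus_verts_def using assms(1) by (intro wf_digraph.wellformed_induce_subgraph)
  from assms(4,5) obtain k l where "f (k + l) \<in> verts C" "f (l + k) \<in> verts C'"
    unfolding has_tail_in_def ray_def by blast
  then have "verts C \<inter> verts C' \<noteq> {}" by (auto simp: add.commute)
  with assms(2,3) H.scc_disj show ?thesis by blast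
qed

lemma equiv_ray_equiv:
  assumes "wf_digraph G"
  shows "equiv {f. solid G f} (ray_equiv G)"
proof (rule equivI)
  show "ray_equiv G \<subseteq> {f. solid G f} \<times> {f. solid G f}" by (auto simp: ray_equiv_def)
  show "refl_on {f. solid G f} (ray_equiv G)"
    by (auto simp: refl_on_def ray_equiv_def solid_def)
  show "sym (ray_equiv G)" by (fastforce simp: sym_def ray_equiv_def)
  show "trans (ray_equiv G)"
  proof (rule transI)
    fix f g h assume fg: "(f, g) \<in> ray_equiv G" and gh: "(g, h) \<in> ray_equiv G"
    have "\<exists>C \<in> sccs_minus G X. has_tail_in f C \<and> has_tail_in h C"
      if X: "finite X" "X \<subseteq> verts G" for X
    proof -
      from fg X obtain C where C: "C \<in> sccs_minus G X" "has_tail_in f C" "has_tail_in g C"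
        by (auto simp: ray_equiv_def)
      from gh X obtain C' where C': "C' \<in> sccs_minus G X" "has_tail_in g C'" "has_tail_in h C'"
        by (auto simp: ray_equiv_def)
      from has_tail_in_unique[OF assms C(1) C'(1) C(3) C'(2)] C C' show ?thesis by blast
    qed
    with fg gh show "(f, h) \<in> ray_equiv G" by (auto simp: ray_equiv_def)
  qed
qed

lemma end_component_unique:
  assumes "wf_digraph G" "\<omega> \<in> ends G" "finite X" "X \<subseteq> verts G"
  shows "\<exists>!C. C \<in> sccs_minus G X \<and> (\<forall>f \<in> \<omega>. has_tail_in f C)"
proof -
  from assms(2) obtain f where f: "solid G f" and \<omega>: "\<omega> = ray_equiv G `` {f}"
    by (auto simp: ends_def elim: quotientE)
  from f assms(3,4) obtain C where C: "C \<in> sccs_minus G X" "has_tail_in f C"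
    by (auto simp: solid_def)
  have "f \<in> \<omega>" using f by (auto simp: \<omega> ray_equiv_def solid_def)
  have "has_tail_in g C" if "g \<in> \<omega>" for g
  proof -
    from that assms(3,4) obtain C' where
      C': "C' \<in> sccs_minus G X" "has_tail_in f C'" "has_tail_in g C'"
      by (auto simp: \<omega> ray_equiv_def)
    from has_tail_in_unique[OF assms(1) C(1) C'(1) C(2) C'(2)] C' show ?thesis by blast
  qed
  with C \<open>f \<in> \<omega>\<close> has_tail_in_unique[OF assms(1)] show ?thesis by blast
qed


section \<open>Normal arborescences\<close>

text \<open>The predicate \<open>tree\<close> of the library forbids directed cycles only, so it does not
  express that the underlying undirected graph is a tree. In \<open>mk_symmetric\<close> every edge yields a
  cycle of length 2, hence the cycles of the underlying graph are those of length at least 3.\<close>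

definition oriented_tree :: "'a pair_pre_digraph \<Rightarrow> bool" where
  "oriented_tree T \<longleftrightarrow> pair_wf_digraph T
     \<and> (\<forall>u v. (u, v) \<in> parcs T \<longrightarrow> (v, u) \<notin> parcs T)
     \<and> connected (with_proj T)
     \<and> \<not> (\<exists>p. pre_digraph.cycle (with_proj (mk_symmetric (with_proj T))) p \<and> 3 \<le> length p)"

definition tree_le :: "'a pair_pre_digraph \<Rightarrow> 'a \<Rightarrow> 'a \<Rightarrow> bool" where
  "tree_le T v w \<longleftrightarrow> (\<exists>p. pre_digraph.apath (with_proj T) v p w)"

definition arborescence :: "'a pair_pre_digraph \<Rightarrow> 'a \<Rightarrow> bool" where
  "arborescence T r \<longleftrightarrow> oriented_tree T \<and> r \<in> pverts T \<and> (\<forall>v \<in> pverts T. tree_le T r v)"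

definition up_closure :: "'a pair_pre_digraph \<Rightarrow> 'a \<Rightarrow> 'a set" where
  "up_closure T v = {w. tree_le T v w}"

text \<open>The \<open>T\<close>-paths are the paths described by \<open>gen_iapath\<close> for the vertex set of \<open>T\<close>.\<close>

definition normal_assistant :: "'a pair_pre_digraph \<Rightarrow> 'a pair_pre_digraph \<Rightarrow> 'a pair_pre_digraph" where
  "normal_assistant D T = \<lparr> pverts = pverts T,
     parcs = parcs T \<union> {(v, w). v \<in> pverts T \<and> w \<in> pverts T
       \<and> \<not> tree_le T v w \<and> \<not> tree_le T w v
       \<and> (\<exists>x \<in> up_closure T v. \<exists>y \<in> up_closure T w.
            \<exists>p. pre_digraph.gen_iapath (with_proj D) (pverts T) x p y)} \<rparr>"

definition normal_in :: "'a pair_pre_digraph \<Rightarrow> 'a pair_pre_digraph \<Rightarrow> bool" where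
  "normal_in D T \<longleftrightarrow> \<not> (\<exists>p. pre_digraph.cycle (with_proj (normal_assistant D T)) p)"

definition end_faithful ::
    "'a pair_pre_digraph \<Rightarrow> 'a \<Rightarrow> (nat \<Rightarrow> 'a) set set \<Rightarrow> bool" where
  "end_faithful T r \<Psi> \<longleftrightarrow> (\<forall>\<omega> \<in> \<Psi>. \<exists>!f. ray (with_proj T) f \<and> f 0 = r \<and> f \<in> \<omega>)"

end

theory Submission
  imports Defs
begin

text \<open>If \<open>X\<close> is down-closed in \<open>T\<close>, then the vertices of \<open>T\<close> outside \<open>X\<close> are partitioned into
  the up-closures of the minimal ones. A walk of \<open>D - X\<close> that passes from one of these branches
  to another yields an edge of the normal assistant between their minimal elements. As the normal
  assistant is acyclic, every strong component of \<open>D - X\<close> meets at most one branch.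

  Two distinct rays of \<open>T\<close> that start in the root are separated into different branches by the
  down-closure of their last common vertex, which gives uniqueness. For existence, climb the tree,
  always moving from \<open>x\<close> to the child whose branch is the only one that \<open>C(\<lceil>x\<rceil>, \<omega>)\<close> meets. If
  some \<open>C(Y, \<omega>)\<close> avoided the resulting ray, it would lie in all the components \<open>C(\<lceil>x\<rceil>, \<omega>)\<close> along
  the ray, so its vertices in \<open>U\<close> would lie above the whole ray, and they only have finitely many
  predecessors. So each \<open>C(X, \<omega>)\<close> contains infinitely many vertices of the ray, and hence a tail.\<close>

section \<open>Reachability and strong components\<close>

text \<open>Expresses walks of an induced subgraph by arcs of \<open>G\<close> confined to
  \<open>S\<close>, so that changing the deleted vertex set becomes monotonicity in
  \<open>S\<close>.\<close>

lemma reachable_induce_iff: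
  "u \<rightarrow>\<^sup>*\<^bsub>G \<restriction> S\<^esub> v \<longleftrightarrow> (u, v) \<in> rtrancl_on S (arcs_ends G)"
proof -
  have arcs: "arcs_ends (G \<restriction> S) = {(x, y) \<in> arcs_ends G. x \<in> S \<and> y \<in> S}"
    by (auto simp: arcs_ends_conv induce_subgraph_def)
  have "(u, v) \<in> rtrancl_on S (arcs_ends G)" if "(u, v) \<in> rtrancl_on S (arcs_ends (G \<restriction> S))"
    using _ subset_refl that by (rule rtrancl_on_mono) (auto simp: arcs)
  moreover have "(u, v) \<in> rtrancl_on S (arcs_ends (G \<restriction> S))"
    if "(u, v) \<in> rtrancl_on S (arcs_ends G)"
    using that
  proof (induction rule: rtrancl_on_induct)
    case (step y z)
    from step.IH _ step.hyps(4) show ?case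
      by (rule rtrancl_on_into_rtrancl_on) (use step.hyps in \<open>simp add: arcs\<close>)
  qed simp
  ultimately show ?thesis by (auto simp: reachable_def)
qed

lemma wf_minus_verts: "wf_digraph G \<Longrightarrow> wf_digraph (minus_verts G X)"
  unfolding minus_verts_def by (rule wf_digraph.wellformed_induce_subgraph)

lemma
  assumes "wf_digraph G" "C \<in> sccs_minus G X"
  shows sccs_minus_verts: "verts C \<subseteq> verts G - X"
    and sccs_minus_eq: "C = G \<restriction> verts C"
    and sccs_minus_reachable:
      "u \<in> verts C \<Longrightarrow> v \<in> verts C \<Longrightarrow> (u, v) \<in> rtrancl_on (verts C) (arcs_ends G)"
proof -
  interpret H: wf_digraph "minus_verts G X" using assms(1) by (rule wf_minus_verts)
  have ind: "induced_subgraph C (minus_verts G X)" and sc: "strongly_connected C"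
    using assms(2) by (auto simp: pre_digraph.sccs_def)
  show vs: "verts C \<subseteq> verts G - X"
    using ind by (auto simp: induced_subgraph_def subgraph_def minus_verts_def)
  show eq: "C = G \<restriction> verts C"
    using ind vs by (auto simp: induced_subgraph_def subgraph_def minus_verts_def compatible_def
        induce_subgraph_def intro!: pre_digraph.equality)
  assume "u \<in> verts C" "v \<in> verts C"
  with sc have "u \<rightarrow>\<^sup>*\<^bsub>C\<^esub> v" by (auto simp: strongly_connected_def)
  with eq have "u \<rightarrow>\<^sup>*\<^bsub>G \<restriction> verts C\<^esub> v" by simp
  then show "(u, v) \<in> rtrancl_on (verts C) (arcs_ends G)"
    by (simp only: reachable_induce_iff)
qed

lemma sccs_minus_absorb:
  assumes G: "wf_digraph G" and C: "C \<in> sccs_minus G X"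
    and uv: "u \<in> verts C" "v \<in> verts C"
    and "(u, w) \<in> rtrancl_on (verts G - X) (arcs_ends G)"
      "(w, v) \<in> rtrancl_on (verts G - X) (arcs_ends G)"
  shows "w \<in> verts C"
proof -
  interpret H: wf_digraph "minus_verts G X" using G by (rule wf_minus_verts)
  have S: "verts C \<in> H.sccs_verts" using C by (simp add: H.sccs_verts_conv)
  have uw: "u \<rightarrow>\<^sup>*\<^bsub>minus_verts G X\<^esub> w" and wv: "w \<rightarrow>\<^sup>*\<^bsub>minus_verts G X\<^esub> v"
    using assms(5,6) by (simp_all add: minus_verts_def reachable_induce_iff)
  have "v \<rightarrow>\<^sup>*\<^bsub>minus_verts G X\<^esub> u" using S uv by (auto simp: H.in_sccs_verts_conv_reachable)
  with wv have "w \<rightarrow>\<^sup>*\<^bsub>minus_verts G X\<^esub> u" by (rule H.reachable_trans)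
  with S uw uv show ?thesis by (auto simp: H.in_sccs_verts_conv_reachable)
qed

text \<open>\<open>C'\<close> is strongly connected and avoids \<open>X\<close>, so its vertices
  stay mutually reachable once \<open>X\<close> is deleted and share one component there.\<close>

lemma sccs_minus_subset:
  assumes G: "wf_digraph G" and C: "C \<in> sccs_minus G X" and C': "C' \<in> sccs_minus G Y"
    and disj: "verts C' \<inter> X = {}" and meet: "verts C \<inter> verts C' \<noteq> {}"
  shows "verts C' \<subseteq> verts C"
proof
  fix w assume w: "w \<in> verts C'"
  from meet obtain u where u: "u \<in> verts C" "u \<in> verts C'" by blast
  have "verts C' \<subseteq> verts G - X" using sccs_minus_verts[OF G C'] disj by blast
  then have "rtrancl_on (verts C') (arcs_ends G) \<subseteq> rtrancl_on (verts G - X) (arcs_ends G)"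
    by (intro subrelI) (rule rtrancl_on_mono[OF subset_refl])
  with sccs_minus_reachable[OF G C'] w u
  have "(u, w) \<in> rtrancl_on (verts G - X) (arcs_ends G)"
    "(w, u) \<in> rtrancl_on (verts G - X) (arcs_ends G)" by blast+
  with sccs_minus_absorb[OF G C u(1) u(1)] show "w \<in> verts C" .
qed

section \<open>Tails of rays and the components of an end\<close>

lemma has_tail_inD:
  assumes "has_tail_in f C"
  obtains k where "\<And>i. k \<le> i \<Longrightarrow> f i \<in> verts C"
proof -
  from assms obtain k where k: "range (\<lambda>i. f (k + i)) \<subseteq> verts C"
    unfolding has_tail_in_def ray_def by blast
  have "f i \<in> verts C" if "k \<le> i" for i
    using k that by (metis le_add_diff_inverse rangeI subsetD)
  with that show ?thesis .
qed

text \<open>Components are induced subgraphs, so the steps of \<open>f\<close> between its late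
  vertices are available in \<open>C\<close>.\<close>

lemma has_tail_inI:
  assumes "wf_digraph G" "C \<in> sccs_minus G X" "ray G f" "\<And>i. k \<le> i \<Longrightarrow> f i \<in> verts C"
  shows "has_tail_in f C"
proof -
  have "f i \<rightarrow>\<^bsub>C\<^esub> f (Suc i)" if "k \<le> i" for i
  proof -
    have "f i \<rightarrow>\<^bsub>G\<^esub> f (Suc i)" "f i \<in> verts C" "f (Suc i) \<in> verts C"
      using assms(3,4) that by (auto simp: ray_def)
    then have "f i \<rightarrow>\<^bsub>G \<restriction> verts C\<^esub> f (Suc i)"
      by (auto simp: arcs_ends_conv induce_subgraph_def)
    with sccs_minus_eq[OF assms(1,2)] show ?thesis by simp
  qed
  moreover have "inj (\<lambda>i. f (k + i))"
    using assms(3) by (auto simp: ray_def intro!: injI dest: injD)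
  moreover have "range (\<lambda>i. f (k + i)) \<subseteq> verts C" using assms(4) by auto
  ultimately have "ray C (\<lambda>i. f (k + i))" by (simp add: ray_def)
  then show ?thesis unfolding has_tail_in_def by blast
qed

lemma ray_reachable:
  assumes "ray G f" "i \<le> j" "\<And>k. i \<le> k \<Longrightarrow> k \<le> j \<Longrightarrow> f k \<in> S"
  shows "(f i, f j) \<in> rtrancl_on S (arcs_ends G)"
  using assms(2,3)
proof (induction j rule: dec_induct)
  case base
  then show ?case by auto
next
  case (step j)
  then have "(f i, f j) \<in> rtrancl_on S (arcs_ends G)" by auto
  moreover have "f j \<rightarrow>\<^bsub>G\<^esub> f (Suc j)" using assms(1) by (auto simp: ray_def)
  moreover have "f (Suc j) \<in> S" using step by auto
  ultimately show ?case by (rule rtrancl_on_into_rtrancl_on)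
qed

lemma
  assumes "wf_digraph G" "\<omega> \<in> ends G" "finite X" "X \<subseteq> verts G"
  shows end_component_in_sccs: "end_component G X \<omega> \<in> sccs_minus G X"
    and end_component_tail: "f \<in> \<omega> \<Longrightarrow> has_tail_in f (end_component G X \<omega>)"
  using theI'[OF end_component_unique[OF assms]] unfolding end_component_def by blast+

text \<open>Late vertices of any ray in \<open>\<omega>\<close> lie in both components, so these
  meet.\<close>

lemma end_component_subset:
  assumes G: "wf_digraph G" and w: "\<omega> \<in> ends G"
    and X: "finite X" "X \<subseteq> verts G" and Y: "finite Y" "Y \<subseteq> verts G"
    and disj: "verts (end_component G Y \<omega>) \<inter> X = {}"
  shows "verts (end_component G Y \<omega>) \<subseteq> verts (end_component G X \<omega>)"
proof (rule sccs_minus_subset[OF G end_component_in_sccs[OF G w X]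
      end_component_in_sccs[OF G w Y] disj])
  obtain f where f: "f \<in> \<omega>"
    using w in_quotient_imp_non_empty[OF equiv_ray_equiv[OF G]] unfolding ends_def by blast
  obtain k where k: "\<And>i. k \<le> i \<Longrightarrow> f i \<in> verts (end_component G X \<omega>)"
    by (rule has_tail_inD[OF end_component_tail[OF G w X f]]) blast
  obtain l where l: "\<And>i. l \<le> i \<Longrightarrow> f i \<in> verts (end_component G Y \<omega>)"
    by (rule has_tail_inD[OF end_component_tail[OF G w Y f]]) blast
  from k[of "max k l"] l[of "max k l"]
  show "verts (end_component G X \<omega>) \<inter> verts (end_component G Y \<omega>) \<noteq> {}" by auto
qed

text \<open>Comparison with a representative \<open>g\<close>: the shared components give both the
  solidity of \<open>f\<close> and its equivalence to \<open>g\<close>.\<close>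

lemma in_end_if_tails:
  assumes G: "wf_digraph G" and w: "\<omega> \<in> ends G" and f: "ray G f"
    and tail: "\<And>X. finite X \<Longrightarrow> X \<subseteq> verts G \<Longrightarrow> has_tail_in f (end_component G X \<omega>)"
  shows "f \<in> \<omega>"
proof -
  from w obtain g where g: "solid G g" and eq: "\<omega> = ray_equiv G `` {g}"
    by (auto simp: ends_def elim: quotientE)
  have "g \<in> \<omega>" using g by (auto simp: eq ray_equiv_def solid_def)
  then have "\<exists>C \<in> sccs_minus G X. has_tail_in g C \<and> has_tail_in f C"
    if "finite X" "X \<subseteq> verts G" for X
    using end_component_in_sccs[OF G w that] end_component_tail[OF G w that] tail[OF that] by blast
  moreover from this f have "solid G f" unfolding solid_def by blast
  ultimately have "(g, f) \<in> ray_equiv G" using g by (simp add: ray_equiv_def)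
  then show ?thesis by (simp add: eq)
qed

lemma acyclic_arcs_ends:
  assumes "wf_digraph G" "\<not> (\<exists>p. pre_digraph.cycle G p)"
  shows "acyclic (arcs_ends G)"
proof -
  interpret wf_digraph G by fact
  show ?thesis
  proof (rule acyclicI, safe)
    fix u assume "(u, u) \<in> (arcs_ends G)\<^sup>+"
    then obtain p where "awalk u p u" "p \<noteq> []" by (auto simp: reachable1_awalk)
    then have "closed_w p" by (auto simp: closed_w_def)
    with assms(2) show False using closed_w_imp_cycle by blast
  qed
qed


section \<open>Arborescences\<close>

text \<open>Membership of \<open>v\<close> excludes the reflexive pairs outside
  \<open>T\<close>.\<close>

lemma tree_le_iff:
  assumes "pair_wf_digraph T"
  shows "tree_le T v w \<longleftrightarrow> v \<in> pverts T \<and> (v, w) \<in> (parcs T)\<^sup>*"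
proof -
  interpret pair_wf_digraph T by fact
  have "tree_le T v w \<longleftrightarrow> v \<rightarrow>\<^sup>*\<^bsub>with_proj T\<^esub> w"
    using wf_digraph.reachable_apath[OF wf_digraph_wp_iff[THEN iffD2, OF assms]]
    by (simp add: tree_le_def)
  also have "\<dots> \<longleftrightarrow> v \<in> pverts T \<and> (v, w) \<in> (parcs T)\<^sup>*"
  proof -
    have "(v, w) \<in> rtrancl_on (pverts T) (parcs T)"
      if "(v, w) \<in> (parcs T)\<^sup>*" "v \<in> pverts T"
      using that by (induction rule: rtrancl_induct)
        (auto intro: rtrancl_on_into_rtrancl_on dest: in_arcsD2)
    then show ?thesis
      by (auto simp: reachable_def dest: rtrancl_on_rtranclI in_rtrancl_on_in_F)
  qed
  finally show ?thesis .
qed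

lemma parcs_mk_symmetric_with_proj:
  "parcs (mk_symmetric (with_proj G)) = parcs G \<union> (parcs G)\<inverse>"
  unfolding parcs_mk_symmetric by force

text \<open>Finding the path in the subgraph induced by \<open>S\<close> keeps all its vertices in
  \<open>S\<close>.\<close>

lemma apath_within:
  assumes "pair_wf_digraph G" "(u, v) \<in> rtrancl_on S (parcs G)" "S \<subseteq> pverts G"
  obtains p where "pre_digraph.apath (with_proj G) u p v" "set (pawalk_verts u p) \<subseteq> S"
proof -
  interpret G: pair_wf_digraph G by fact
  let ?H = "with_proj G \<restriction> S"
  interpret H: wf_digraph ?H by (rule G.wellformed_induce_subgraph)
  have "u \<rightarrow>\<^sup>*\<^bsub>?H\<^esub> v"
    using assms(2) by (simp only: reachable_induce_iff with_proj_simps)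
  then obtain p where p: "H.apath u p v" unfolding H.reachable_apath ..
  have sub: "subgraph ?H (with_proj G)"
    using assms(3) by (intro G.subgraph_induce_subgraphI) simp
  have "G.apath u p v" using p sub by (rule G.subgraph_apath_imp_apath)
  moreover have "set (H.awalk_verts u p) \<subseteq> S"
  proof
    fix x assume "x \<in> set (H.awalk_verts u p)"
    moreover have "u \<in> verts ?H" "set p \<subseteq> arcs ?H"
      using p by (simp_all only: H.apath_def H.awalk_def)
    ultimately have "x \<in> verts ?H" by (rule H.awalk_verts_in_verts[rotated 2])
    then show "x \<in> S" by simp
  qed
  moreover have "H.awalk_verts = pawalk_verts"
    using compatible_awalk_verts[of "with_proj G" ?H] sub
    by (simp only: subgraph_def awalk_verts_with_proj_eq)
  ultimately show ?thesis using that by (simp only:)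
qed

text \<open>A directed cycle of \<open>T\<close> is also a cycle of its symmetric closure. Those of
  length at least 3 are excluded there, and a shorter one would be a loop or a pair of opposite
  arcs.\<close>

lemma oriented_tree_acyclic:
  assumes "oriented_tree T"
  shows "acyclic (parcs T)"
proof -
  interpret T: pair_wf_digraph T using assms by (simp add: oriented_tree_def)
  have asym: "(v, u) \<notin> parcs T" if "(u, v) \<in> parcs T" for u v
    using assms that by (auto simp: oriented_tree_def)
  have "\<not> pre_digraph.cycle (with_proj T) p" for p
  proof
    assume cyc: "pre_digraph.cycle (with_proj T) p"
    then obtain u where u: "T.awalk u p u" "distinct (tl (pawalk_verts u p))" "p \<noteq> []"
      unfolding T.cycle_def by auto
    have "3 \<le> length p"
    proof (rule ccontr)
      assume "\<not> 3 \<le> length p"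
      then have "length p = Suc 0 \<or> length p = Suc (Suc 0)"
        using u(3) by (cases "length p") auto
      then consider e where "p = [e]" | e e' where "p = [e, e']"
        by (auto simp: length_Suc_conv)
      then show False
      proof cases
        case 1
        with u(1) asym show False by (cases e) (auto simp: T.awalk_Cons_iff T.awalk_Nil_iff)
      next
        case 2
        with u(1) asym show False
          by (cases e; cases e') (auto simp: T.awalk_Cons_iff T.awalk_Nil_iff)
      qed
    qed
    moreover have "pre_digraph.cycle (with_proj (mk_symmetric (with_proj T))) p"
    proof -
      have "parcs T \<subseteq> parcs (mk_symmetric (with_proj T))"
        by (simp add: parcs_mk_symmetric_with_proj)
      with u show ?thesis
        unfolding pre_digraph.cycle_def pre_digraph.awalk_def
        by (intro exI[of _ u]) (auto simp: cas_with_proj_eq awalk_verts_with_proj_eq)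
    qed
    ultimately show False using assms by (auto simp: oriented_tree_def)
  qed
  then have "acyclic (arcs_ends (with_proj T))"
    by (intro acyclic_arcs_ends T.wf_digraph_axioms) blast
  then show ?thesis by (simp only: with_proj_simps)
qed

section \<open>The tree order: unique parents, linear and finite down-closures\<close>

locale rooted_arborescence =
  fixes T :: "'a pair_pre_digraph" and r :: 'a
  assumes arb: "arborescence T r"
begin

sublocale T: pair_wf_digraph T
  using arb by (simp add: arborescence_def oriented_tree_def)

abbreviation le (infix "\<preceq>" 50) where "u \<preceq> v \<equiv> (u, v) \<in> (parcs T)\<^sup>*"

lemma root_in: "r \<in> pverts T"
  using arb by (simp add: arborescence_def)

lemma root_le: "v \<in> pverts T \<Longrightarrow> r \<preceq> v"
  using arb by (simp add: arborescence_def tree_le_iff[OF T.pair_wf_digraph_axioms])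

lemma acyclic_T: "acyclic (parcs T)"
  using arb unfolding arborescence_def by (blast intro: oriented_tree_acyclic)

lemma le_in_verts': "u \<preceq> v \<Longrightarrow> v \<in> pverts T \<Longrightarrow> u \<in> pverts T"
  by (induction rule: converse_rtrancl_induct) (auto dest: T.in_arcsD1)

lemma no_arc_to_root: "(u, r) \<notin> parcs T"
proof
  assume "(u, r) \<in> parcs T"
  moreover from this have "r \<preceq> u" by (intro root_le) (rule T.in_arcsD1)
  ultimately have "(r, r) \<in> (parcs T)\<^sup>+" by (rule rtrancl_into_trancl1[rotated])
  with acyclic_T show False by (simp add: acyclic_def)
qed

text \<open>Walks from the root to two distinct parents of \<open>v\<close> avoid \<open>v\<close>,
  as \<open>T\<close> is acyclic. So the parents are joined by an undirected path avoiding
  \<open>v\<close>, which closes up through \<open>v\<close> to a forbidden cycle.\<close>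

lemma parent_unique:
  assumes u: "(u, v) \<in> parcs T" and u': "(u', v) \<in> parcs T"
  shows "u = u'"
proof (rule ccontr)
  assume ne: "u \<noteq> u'"
  define M where "M = mk_symmetric (with_proj T)"
  interpret M: pair_wf_digraph M unfolding M_def by (rule T.wellformed_mk_symmetric)
  have M_eq: "parcs M = parcs T \<union> (parcs T)\<inverse>"
    by (auto simp: M_def parcs_mk_symmetric_with_proj)
  have symM: "(b, a) \<in> parcs M" if "(a, b) \<in> parcs M" for a b
    using that by (auto simp: M_eq)
  have TM: "parcs T \<subseteq> parcs M" by (simp add: M_eq)
  let ?S = "pverts T - {v}"
  have reach: "(r, w) \<in> rtrancl_on ?S (parcs M)" if "(w, v) \<in> parcs T" for w
  proof -
    have ne: "x \<noteq> v" if "x \<preceq> w" for x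
    proof
      assume "x = v"
      with \<open>x \<preceq> w\<close> \<open>(w, v) \<in> parcs T\<close> have "(v, v) \<in> (parcs T)\<^sup>+"
        by (blast intro: rtrancl_into_trancl1)
      with acyclic_T show False by (simp add: acyclic_def)
    qed
    have "w \<in> pverts T" using that by (rule T.in_arcsD1)
    then have "r \<preceq> w" by (rule root_le)
    then show ?thesis
    proof (induction rule: converse_rtrancl_induct)
      case base
      with \<open>w \<in> pverts T\<close> ne[of w] show ?case by auto
    next
      case (step x y)
      from step(1,2) have "x \<preceq> w" by (rule converse_rtrancl_into_rtrancl)
      with step ne[of x] have "x \<in> ?S" by (auto dest: T.in_arcsD1)
      with step TM show ?case by (blast intro: converse_rtrancl_on_into_rtrancl_on)
    qed
  qed
  \<comment> \<open>By symmetry, the walk from \<open>r\<close> to \<open>u\<close> can be reversed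
    and continued to \<open>u'\<close>.\<close>
  have "sym (rtrancl_on ?S (parcs M))"
    by (rule rtrancl_on_sym) (auto intro: symI symM)
  with reach[OF u] reach[OF u'] have "(u, u') \<in> rtrancl_on ?S (parcs M)"
    by (meson rtrancl_on_trans symD)
  moreover have "?S \<subseteq> pverts M" by (auto simp: M_def)
  ultimately obtain p where "M.apath u p u'" and vs: "set (pawalk_verts u p) \<subseteq> ?S"
    by (rule apath_within[OF M.pair_wf_digraph_axioms])
  then have pM: "M.awalk u p u'" "distinct (pawalk_verts u p)" by (auto simp: M.apath_def)
  from vs have vp: "v \<notin> set (pawalk_verts u p)" by auto
  let ?q = "(v, u) # p @ [(u', v)]"
  have "M.awalk v ?q v"
  proof -
    have "(v, u) \<in> parcs M" "(u', v) \<in> parcs M" using u u' TM symM by auto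
    moreover from this have "v \<in> pverts M" by (auto dest: M.in_arcsD2)
    ultimately show ?thesis using pM(1)
      by (simp add: M.awalk_Cons_iff M.awalk_Nil_iff)
  qed
  moreover have "pawalk_verts u (p @ [(u', v)]) = pawalk_verts u p @ [v]"
    using pM(1) by (induction p arbitrary: u) (auto simp: M.awalk_Cons_iff M.awalk_Nil_iff)
  ultimately have "pre_digraph.cycle (with_proj M) ?q"
    using pM(2) vp unfolding M.cycle_def by (intro exI[of _ v]) simp
  \<comment> \<open>As \<open>u\<close> and \<open>u'\<close> differ, \<open>p\<close> has an arc,
    which brings the length of \<open>?q\<close> to at least 3.\<close>
  moreover have "p \<noteq> []" using ne pM(1) by (auto simp: M.awalk_Nil_iff)
  then have "3 \<le> length ?q" by (cases p) auto
  ultimately show False using arb unfolding arborescence_def oriented_tree_def M_def by blast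
qed

text \<open>Induction along the path from \<open>v\<close> to \<open>w\<close>: parents are unique,
  so \<open>u\<close> is the new vertex \<open>z\<close> itself or lies below its parent
  \<open>y\<close>.\<close>

lemma le_linear:
  assumes "u \<preceq> w" "v \<preceq> w"
  shows "u \<preceq> v \<or> v \<preceq> u"
  using assms(2,1)
proof (induction rule: rtrancl_induct)
  case base
  then show ?case by simp
next
  case (step y z)
  from \<open>u \<preceq> z\<close> show ?case
  proof (cases rule: rtranclE)
    case base
    with step.hyps show ?thesis by (auto intro: rtrancl_into_rtrancl)
  next
    case (step y')
    with step.hyps have "y' = y" by (blast intro: parent_unique)
    with step step.IH show ?thesis by blast
  qed
qed

lemma down_set_arc: "(u, v) \<in> parcs T \<Longrightarrow> {x. x \<preceq> v} = insert v {x. x \<preceq> u}"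
  by (auto elim!: rtranclE[of _ v] dest: parent_unique intro: rtrancl_into_rtrancl)

lemma down_set_root: "{x. x \<preceq> r} = {r}"
  using no_arc_to_root by (auto elim: rtranclE)

text \<open>Each arc on the path from the root adds one vertex.\<close>

lemma finite_down_set:
  assumes "v \<in> pverts T"
  shows "finite {u. u \<preceq> v}"
  using root_le[OF assms]
proof (induction rule: rtrancl_induct)
  case base
  then show ?case by (simp add: down_set_root)
next
  case (step y z)
  then show ?case by (simp add: down_set_arc)
qed

section \<open>Branches above a down-closed set\<close>

definition down_closed :: "'a set \<Rightarrow> bool" where
  "down_closed X \<longleftrightarrow> (\<forall>u v. (u, v) \<in> parcs T \<longrightarrow> v \<in> X \<longrightarrow> u \<in> X)"

lemma down_closedD: "down_closed X \<Longrightarrow> v \<in> X \<Longrightarrow> u \<preceq> v \<Longrightarrow> u \<in> X"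
  by (rotate_tac 2, induction rule: converse_rtrancl_induct) (auto simp: down_closed_def)

lemma down_closed_down_set: "down_closed {u. u \<preceq> v}"
  by (auto simp: down_closed_def intro: converse_rtrancl_into_rtrancl)

text \<open>For down-closed \<open>X\<close> and \<open>v\<close> in \<open>T\<close>,
  \<open>c\<close> is the first vertex outside \<open>X\<close> on the path from the root to
  \<open>v\<close>; it names the branch of \<open>v\<close>. The root has no parent, so it satisfies
  the last condition vacuously.\<close>

definition branch :: "'a set \<Rightarrow> 'a \<Rightarrow> 'a \<Rightarrow> bool" where
  "branch X v c \<longleftrightarrow> c \<preceq> v \<and> c \<notin> X \<and> (\<forall>p. (p, c) \<in> parcs T \<longrightarrow> p \<in> X)"

text \<open>Along the path from the root, a vertex outside \<open>X\<close> is minimal itself if its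
  parent is in \<open>X\<close>, and otherwise inherits the minimal element of its parent.\<close>

lemma branch_exists:
  assumes "v \<in> pverts T" "v \<notin> X"
  obtains c where "branch X v c"
proof -
  have "\<exists>c. branch X v c" using root_le[OF assms(1)] assms(2)
  proof (induction rule: rtrancl_induct)
    case base
    then show ?case using no_arc_to_root by (auto simp: branch_def)
  next
    case (step y z)
    show ?case
    proof (cases "y \<in> X")
      case True
      with step have "branch X z z" by (auto simp: branch_def dest: parent_unique)
      then show ?thesis ..
    next
      case False
      with step obtain c where "branch X y c" by blast
      with step.hyps have "branch X z c" by (auto simp: branch_def)
      then show ?thesis ..
    qed
  qed
  with that show ?thesis by blast
qed

text \<open>Otherwise the parent of \<open>d\<close> lies in \<open>X\<close> and above
  \<open>c\<close>, which forces \<open>c\<close> into \<open>X\<close>. Allowing different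
  \<open>v\<close> and \<open>w\<close> makes the minimal elements of different branches
  incomparable.\<close>

lemma branch_unique_le:
  assumes "down_closed X" "branch X v c" "branch X w d" "c \<preceq> d"
  shows "c = d"
  using \<open>c \<preceq> d\<close>
proof (cases rule: rtranclE)
  case (step p)
  with assms have "p \<in> X" by (auto simp: branch_def)
  with assms(1) have "c \<in> X" using step by (blast intro: down_closedD)
  with assms(2) show ?thesis by (simp add: branch_def)
qed

lemma branch_unique:
  assumes "down_closed X" "branch X v c" "branch X v d"
  shows "c = d"
proof -
  have "c \<preceq> d \<or> d \<preceq> c" using assms by (intro le_linear) (auto simp: branch_def)
  with assms show ?thesis by (metis branch_unique_le)
qed

text \<open>\<open>x\<close> is the only parent of \<open>y\<close>, and acyclicity keeps
  \<open>y\<close> out of the down-closure of \<open>x\<close>.\<close>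

lemma branch_child:
  assumes "(x, y) \<in> parcs T" "y \<preceq> v"
  shows "branch {u. u \<preceq> x} v y"
proof -
  have "\<not> y \<preceq> x"
  proof
    assume "y \<preceq> x"
    then have "(y, y) \<in> (parcs T)\<^sup>+" using assms(1) by (rule rtrancl_into_trancl1)
    with acyclic_T show False by (simp add: acyclic_def)
  qed
  moreover have "p = x" if "(p, y) \<in> parcs T" for p
    using that assms(1) by (rule parent_unique)
  ultimately show ?thesis using assms(2) by (auto simp: branch_def)
qed

section \<open>Ascending chains as rays\<close>

lemma chain_le:
  assumes "\<And>i. (f i, f (Suc i)) \<in> parcs T" "i \<le> j"
  shows "f i \<preceq> f j"
  using assms(2) by (induction j rule: dec_induct) (auto intro: rtrancl_into_rtrancl assms(1))

lemma chain_less: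
  assumes "\<And>i. (f i, f (Suc i)) \<in> parcs T" "i < j"
  shows "\<not> f j \<preceq> f i"
proof
  assume "f j \<preceq> f i"
  moreover have "f (Suc i) \<preceq> f j" using assms(2) by (intro chain_le assms(1)) simp
  ultimately have "f (Suc i) \<preceq> f i" by (meson rtrancl_trans)
  with branch_child[OF assms(1)[of i] rtrancl_refl] show False by (simp add: branch_def)
qed

lemma inj_chain:
  assumes "\<And>i. (f i, f (Suc i)) \<in> parcs T"
  shows "inj f"
proof (rule linorder_injI)
  fix i j :: nat assume "i < j"
  with chain_less[of f, OF assms] show "f i \<noteq> f j" by force
qed

lemma ray_chain:
  assumes "\<And>i. (f i, f (Suc i)) \<in> parcs T"
  shows "ray (with_proj T) f"
proof -
  have "range f \<subseteq> pverts T" using assms T.in_arcsD1 by blast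
  with assms inj_chain[of f, OF assms] show ?thesis by (simp add: ray_def)
qed

text \<open>The chain starts in the root and parents are unique, so no predecessor of
  \<open>f n\<close> is missed. A set that avoids the chain thus avoids all these
  down-closures.\<close>

lemma down_set_chain:
  assumes "\<And>i. (f i, f (Suc i)) \<in> parcs T" "f 0 = r"
  shows "{u. u \<preceq> f n} \<subseteq> range f"
proof (induction n)
  case 0
  then show ?case using assms(2) by (auto simp: down_set_root)
next
  case (Suc n)
  then show ?case using down_set_arc[OF assms(1)[of n]] by auto
qed

end


section \<open>Normality\<close>

locale normal_arborescence = rooted_arborescence T r for T :: "'a pair_pre_digraph" and r +
  fixes D :: "'a pair_pre_digraph"
  assumes wf_D: "pair_wf_digraph D"
    and T_sub: "subgraph (with_proj T) (with_proj D)"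
    and normal: "normal_in D T"
begin

abbreviation "H \<equiv> normal_assistant D T"

lemma pverts_sub: "pverts T \<subseteq> pverts D" and parcs_sub: "parcs T \<subseteq> parcs D"
  using T_sub by (auto simp: subgraph_def)

lemma wf_D': "wf_digraph (with_proj D)"
  using wf_D by (simp add: wf_digraph_wp_iff)

lemma acyclic_H: "acyclic (parcs H)"
proof -
  have "pair_wf_digraph H"
    by unfold_locales (auto simp: normal_assistant_def dest: T.in_arcsD1 T.in_arcsD2)
  then have "wf_digraph (with_proj H)" by (simp only: wf_digraph_wp_iff)
  then have "acyclic (arcs_ends (with_proj H))"
    using normal unfolding normal_in_def by (rule acyclic_arcs_ends)
  then show ?thesis by (simp only: with_proj_simps)
qed

text \<open>The walk meets \<open>T\<close> only in its ends, so it shortens to a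
  \<open>T\<close>-path between the up-closures of \<open>c\<close> and \<open>d\<close>, which are
  incomparable as minimal elements of different branches.\<close>

lemma assistant_arc:
  assumes X: "down_closed X" and s: "branch X s c" "s \<in> pverts T"
    and z: "branch X z d" "z \<in> pverts T" and "c \<noteq> d"
    and walk: "(s, z) \<in> rtrancl_on (pverts D - pverts T \<union> {s, z}) (parcs D)"
  shows "(c, d) \<in> parcs H"
proof -
  interpret D: pair_wf_digraph D by (rule wf_D)
  \<comment> \<open>A vertex has only one branch, so the ends differ and the path found below is
    non-trivial.\<close>
  have "s \<noteq> z" using X s(1) z(1) \<open>c \<noteq> d\<close> by (blast dest: branch_unique)
  have "pverts D - pverts T \<union> {s, z} \<subseteq> pverts D" using s(2) z(2) pverts_sub by auto
  with wf_D walk obtain p where p: "D.apath s p z"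
    and vs: "set (pawalk_verts s p) \<subseteq> pverts D - pverts T \<union> {s, z}"
    by (rule apath_within)
  have "p \<noteq> []" using p \<open>s \<noteq> z\<close> by (auto simp: D.apath_Nil_iff)
  moreover have "set (D.inner_verts p) \<inter> pverts T = {}"
    using D.set_inner_verts[OF p] vs by auto
  ultimately have "D.gen_iapath (pverts T) s p z"
    using p s(2) z(2) by (simp add: D.gen_iapath_def)
  moreover have cd: "c \<in> pverts T" "d \<in> pverts T"
    using s z by (auto simp: branch_def dest: le_in_verts')
  moreover have "\<not> c \<preceq> d" "\<not> d \<preceq> c"
    using branch_unique_le[OF X] s(1) z(1) \<open>c \<noteq> d\<close> by metis+
  moreover have "s \<in> up_closure T c" "z \<in> up_closure T d"
    using s(1) z(1) cd by (simp_all add: up_closure_def tree_le_iff[OF T.pair_wf_digraph_axioms] branch_def)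
  ultimately show ?thesis
    by (auto simp: normal_assistant_def tree_le_iff[OF T.pair_wf_digraph_axioms])
qed

text \<open>In the conclusion, \<open>s\<close> is the last vertex of \<open>T\<close> on the walk from \<open>t\<close> to \<open>z\<close>.\<close>

lemma walk_branch:
  assumes X: "down_closed X" and t: "t \<in> pverts T" "branch X t c"
    and walk: "(t, z) \<in> rtrancl_on (pverts D - X) (parcs D)"
  shows "\<exists>s d. s \<in> pverts T \<and> branch X s d \<and> (c, d) \<in> (parcs H)\<^sup>* \<and> (z \<in> pverts T \<longrightarrow> z = s)
    \<and> (s, z) \<in> rtrancl_on (pverts D - pverts T \<union> {s}) (parcs D)"
  using walk
proof (induction rule: rtrancl_on_induct)
  case base
  show ?case by (rule exI[of _ t], rule exI[of _ c]) (use t in simp)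
next
  case (step y z)
  then obtain s d where s: "s \<in> pverts T" "branch X s d" "(c, d) \<in> (parcs H)\<^sup>*"
    and sy: "(s, y) \<in> rtrancl_on (pverts D - pverts T \<union> {s}) (parcs D)" by blast
  \<comment> \<open>Admitting \<open>z\<close> as a further vertex covers both cases below, whether
    or not the walk returns to \<open>T\<close> there.\<close>
  have "(s, y) \<in> rtrancl_on (pverts D - pverts T \<union> {s, z}) (parcs D)"
    using sy by (rule rtrancl_on_mono[OF subset_refl, rotated]) auto
  then have sz: "(s, z) \<in> rtrancl_on (pverts D - pverts T \<union> {s, z}) (parcs D)"
    using step.hyps(2) by (rule rtrancl_on_into_rtrancl_on) simp
  show ?case
  proof (cases "z \<in> pverts T")
    case False
    then have "pverts D - pverts T \<union> {s, z} = pverts D - pverts T \<union> {s}"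
      using step.hyps by auto
    with sz s False show ?thesis by auto
  next
    case True
    then obtain e where e: "branch X z e" using step.hyps by (auto elim: branch_exists)
    \<comment> \<open>Back in \<open>T\<close> at \<open>z\<close>, the walk has either stayed in
      its branch or contributed an arc of \<open>H\<close>.\<close>
    have "(d, e) \<in> (parcs H)\<^sup>*"
      using assistant_arc[OF X s(2,1) e True _ sz] by (cases "d = e") auto
    with s(3) have "(c, e) \<in> (parcs H)\<^sup>*" by (rule rtrancl_trans)
    with True e show ?thesis by (intro exI[of _ z] exI[of _ e]) auto
  qed
qed

text \<open>Walks both ways between \<open>t\<close> and \<open>s\<close> outside \<open>X\<close>
  make their minimal elements mutually reachable in \<open>H\<close>, and acyclicity identifies
  them.\<close>

lemma component_in_branch:
  assumes X: "down_closed X" and C: "C \<in> sccs_minus (with_proj D) X"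
    and t: "t \<in> verts C" "t \<in> pverts T" "branch X t c"
    and s: "s \<in> verts C" "s \<in> pverts T"
  shows "c \<preceq> s"
proof -
  have vs: "verts C \<subseteq> pverts D - X" using sccs_minus_verts[OF wf_D' C] by simp
  then have "s \<notin> X" using s by blast
  with s(2) obtain d where d: "branch X s d" by (rule branch_exists)
  have H: "(a, b) \<in> (parcs H)\<^sup>*"
    if "v \<in> verts C" "v \<in> pverts T" "branch X v a" "w \<in> verts C" "w \<in> pverts T" "branch X w b"
    for v w a b
  proof -
    have "(v, w) \<in> rtrancl_on (verts C) (parcs D)"
      using sccs_minus_reachable[OF wf_D' C that(1,4)] by simp
    then have "(v, w) \<in> rtrancl_on (pverts D - X) (parcs D)"
      by (rule rtrancl_on_mono[OF subset_refl vs])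
    from walk_branch[OF X that(2,3) this] that(5) obtain b'
      where "branch X w b'" "(a, b') \<in> (parcs H)\<^sup>*" by blast
    with branch_unique[OF X that(6)] show ?thesis by blast
  qed
  have "(c, d) \<in> (parcs H)\<^sup>*" "(d, c) \<in> (parcs H)\<^sup>*"
    using H[OF t s d] H[OF s d t] by auto
  then have "c = d" by (rule antisymD[OF acyclic_impl_antisym_rtrancl[OF acyclic_H]])
  with d show ?thesis by (simp add: branch_def)
qed

section \<open>Uniqueness of the rooted ray in an end\<close>

lemma ray_in_D: "ray (with_proj T) f \<Longrightarrow> ray (with_proj D) f"
  using pverts_sub parcs_sub by (auto simp: ray_def)

lemma down_set_sub: "v \<in> pverts T \<Longrightarrow> {u. u \<preceq> v} \<subseteq> pverts D"
  using pverts_sub by (auto dest: le_in_verts')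

text \<open>Induction along the rays: after deleting the down-closure of the common vertex
  \<open>f n\<close>, both have tails in one component. It meets only one branch, so the next
  vertices agree.\<close>

lemma rays_in_end_eq:
  assumes w: "\<omega> \<in> ends (with_proj D)"
    and f: "ray (with_proj T) f" "f 0 = r" "f \<in> \<omega>" and g: "ray (with_proj T) g" "g 0 = r" "g \<in> \<omega>"
  shows "f = g"
proof
  fix n
  have arcs: "(f i, f (Suc i)) \<in> parcs T" "(g i, g (Suc i)) \<in> parcs T" for i
    using f(1) g(1) by (simp_all add: ray_def)
  show "f n = g n"
  proof (induction n)
    case 0
    then show ?case using f g by simp
  next
    case (Suc n)
    let ?X = "{u. u \<preceq> f n}" and ?C = "end_component (with_proj D) {u. u \<preceq> f n} \<omega>"
    have "f n \<in> pverts T" using arcs(1) by (rule T.in_arcsD1)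
    then have X: "finite ?X" "?X \<subseteq> verts (with_proj D)"
      using finite_down_set down_set_sub by simp_all
    obtain k where k: "\<And>i. k \<le> i \<Longrightarrow> f i \<in> verts ?C"
      by (rule has_tail_inD[OF end_component_tail[OF wf_D' w X f(3)]]) blast
    obtain l where l: "\<And>i. l \<le> i \<Longrightarrow> g i \<in> verts ?C"
      by (rule has_tail_inD[OF end_component_tail[OF wf_D' w X g(3)]]) blast
    \<comment> \<open>This index lies in both tails and beyond \<open>n\<close>, so
      \<open>f i\<close> and \<open>g i\<close> are above the next vertices to be compared.\<close>
    define i where "i = max (Suc n) (max k l)"
    have C: "f i \<in> verts ?C" "g i \<in> verts ?C" using k l by (simp_all add: i_def)
    have T: "f i \<in> pverts T" "g i \<in> pverts T" using arcs T.in_arcsD1 by blast+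
    have "f (Suc n) \<preceq> f i" "g (Suc n) \<preceq> g i"
      by (simp_all add: chain_le arcs i_def)
    moreover have "(f n, g (Suc n)) \<in> parcs T" using arcs(2)[of n] Suc.IH by simp
    ultimately have bf: "branch ?X (f i) (f (Suc n))" and bg: "branch ?X (g i) (g (Suc n))"
      using arcs(1) by (blast intro: branch_child)+
    have "f (Suc n) \<preceq> g i"
      by (rule component_in_branch[OF down_closed_down_set
            end_component_in_sccs[OF wf_D' w X] C(1) T(1) bf C(2) T(2)])
    with arcs(1) have "branch ?X (g i) (f (Suc n))" by (rule branch_child)
    from branch_unique[OF down_closed_down_set this bg] show ?case .
  qed
qed

section \<open>Existence of a rooted ray in an end in the closure of \<open>U\<close>\<close>

context
  fixes \<omega> :: "(nat \<Rightarrow> 'a) set" and U :: "'a set"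
  assumes w: "\<omega> \<in> ends (with_proj D)" and cl: "in_closure (with_proj D) \<omega> U"
    and U: "U \<subseteq> pverts T"
begin

abbreviation comp :: "'a set \<Rightarrow> 'a set" where
  "comp X \<equiv> verts (end_component (with_proj D) X \<omega>)"

text \<open>The closure of \<open>U\<close> enters here: it supplies vertices of \<open>T\<close> in
  the components of \<open>\<omega>\<close>.\<close>

lemma comp_meets:
  assumes "finite X" "X \<subseteq> pverts D"
  obtains u where "u \<in> comp X" "u \<in> U" "u \<in> pverts T" "u \<notin> X"
proof -
  have "comp X \<inter> U \<noteq> {}" using cl assms by (simp add: in_closure_def)
  moreover have "comp X \<subseteq> pverts D - X"
    using sccs_minus_verts[OF wf_D' end_component_in_sccs[OF wf_D' w]] assms by simp
  ultimately show ?thesis using U that by blast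
qed

text \<open>The strict down-closure of \<open>x\<close> is that of its parent, or empty at the root,
  so the assumption is the invariant of the climb. Deleting \<open>x\<close> too shrinks the
  component, which stays above \<open>x\<close>; a vertex \<open>u\<close> of \<open>T\<close> in it
  selects the child \<open>y\<close>, and no other branch is met.\<close>

lemma comp_child:
  assumes x: "x \<in> pverts T" and comp: "comp ({u. u \<preceq> x} - {x}) \<inter> pverts T \<subseteq> {v. x \<preceq> v}"
  obtains y where "(x, y) \<in> parcs T" "comp {u. u \<preceq> x} \<inter> pverts T \<subseteq> {v. y \<preceq> v}"
proof -
  let ?X = "{u. u \<preceq> x}"
  have X: "finite ?X" "?X \<subseteq> verts (with_proj D)"
    using finite_down_set[OF x] down_set_sub[OF x] by simp_all
  obtain u where u: "u \<in> comp ?X" "u \<in> pverts T" "u \<notin> ?X"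
    using X by (auto elim: comp_meets)
  have "comp ?X \<inter> ?X = {}"
    using sccs_minus_verts[OF wf_D' end_component_in_sccs[OF wf_D' w X]] by blast
  then have "comp ?X \<subseteq> comp (?X - {x})"
    using X by (intro end_component_subset wf_D' w) auto
  with u comp have "x \<preceq> u" by blast
  moreover have "x \<noteq> u" using u by blast
  ultimately obtain y where y: "(x, y) \<in> parcs T" "y \<preceq> u" by (auto elim: converse_rtranclE)
  have "y \<preceq> v" if "v \<in> comp ?X" "v \<in> pverts T" for v
    by (rule component_in_branch[OF down_closed_down_set end_component_in_sccs[OF wf_D' w X]
          u(1,2) branch_child[OF y] that])
  with y(1) that show ?thesis by blast
qed

lemma chain_exists:
  obtains f where "f 0 = r" "\<And>i. (f i, f (Suc i)) \<in> parcs T"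
    "\<And>i. comp {u. u \<preceq> f i} \<inter> pverts T \<subseteq> {v. f (Suc i) \<preceq> v}"
proof -
  \<comment> \<open>\<open>P\<close> is the invariant of the climb, pinned to the root at index 0;
    \<open>Q\<close> is a move to the selected child.\<close>
  define P where "P n x \<longleftrightarrow> x \<in> pverts T \<and> (n = 0 \<longrightarrow> x = r)
    \<and> comp ({u. u \<preceq> x} - {x}) \<inter> pverts T \<subseteq> {v. x \<preceq> v}" for n :: nat and x
  define Q where "Q x y \<longleftrightarrow> (x, y) \<in> parcs T
    \<and> comp {u. u \<preceq> x} \<inter> pverts T \<subseteq> {v. y \<preceq> v}" for x y
  have "\<exists>f. \<forall>n. P n (f n) \<and> Q (f n) (f (Suc n))"
  proof (rule dependent_nat_choice)
    \<comment> \<open>At the root the invariant holds because all of \<open>T\<close> lies above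
      it.\<close>
    show "\<exists>x. P 0 x" using root_in root_le by (auto simp: P_def)
  next
    fix x n assume "P n x"
    then obtain y where xy: "(x, y) \<in> parcs T"
      and y': "comp {u. u \<preceq> x} \<inter> pverts T \<subseteq> {v. y \<preceq> v}"
      unfolding P_def using comp_child[of x] by metis
    then have y: "Q x y" by (simp add: Q_def)
    have "y \<notin> {u. u \<preceq> x}" using branch_child[OF xy rtrancl_refl] by (simp add: branch_def)
    then have "{u. u \<preceq> y} - {y} = {u. u \<preceq> x}" using down_set_arc[OF xy] by simp
    with y have "P (Suc n) y" by (auto simp: P_def Q_def dest: T.in_arcsD2)
    with y show "\<exists>y. P (Suc n) y \<and> Q x y" by blast
  qed
  then obtain f where "\<forall>n. P n (f n) \<and> Q (f n) (f (Suc n))" ..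
  then have "P 0 (f 0)" and Q: "Q (f n) (f (Suc n))" for n by simp_all
  then have "f 0 = r" by (simp add: P_def)
  moreover from Q have "(f n, f (Suc n)) \<in> parcs T"
    and "comp {u. u \<preceq> f n} \<inter> pverts T \<subseteq> {v. f (Suc n) \<preceq> v}" for n
    by (simp_all only: Q_def)
  ultimately show ?thesis by (rule that)
qed

lemma ray_in_closure_end:
  obtains f where "ray (with_proj T) f" "f 0 = r" "f \<in> \<omega>"
proof -
  obtain f where f0: "f 0 = r" and arcs: "\<And>i. (f i, f (Suc i)) \<in> parcs T"
    and comp: "\<And>i. comp {u. u \<preceq> f i} \<inter> pverts T \<subseteq> {v. f (Suc i) \<preceq> v}"
    by (rule chain_exists) blast
  have fT: "f i \<in> pverts T" for i using arcs by (rule T.in_arcsD1)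
  have inj: "inj f" using arcs by (rule inj_chain)
  have ray: "ray (with_proj T) f" using arcs by (rule ray_chain)
  note down = finite_down_set[OF fT] down_set_sub[OF fT]
  have often: "\<exists>j>n. f j \<in> comp X" if X: "finite X" "X \<subseteq> pverts D" for X n
  proof -
    \<comment> \<open>Deleting also the down-closure of \<open>f n\<close> forces any vertex of the
      ray found in \<open>comp ?Y\<close> to have index above \<open>n\<close>.\<close>
    let ?Y = "X \<union> {u. u \<preceq> f n}"
    have Y: "finite ?Y" "?Y \<subseteq> verts (with_proj D)" using X down[of n] by auto
    have disj: "comp ?Y \<inter> ?Y = {}"
      using sccs_minus_verts[OF wf_D' end_component_in_sccs[OF wf_D' w Y]] by blast
    obtain u where u: "u \<in> comp ?Y" "u \<in> pverts T"
      by (rule comp_meets[of ?Y]) (use Y in \<open>simp_all only: with_proj_simps\<close>)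
    have "comp ?Y \<inter> range f \<noteq> {}"
    proof
      assume "comp ?Y \<inter> range f = {}"
      \<comment> \<open>Avoiding the ray, \<open>comp ?Y\<close> avoids every down-closure along it
        and so lies in all their components; this puts \<open>u\<close> above the whole ray.\<close>
      then have "comp ?Y \<inter> {u. u \<preceq> f k} = {}" for k
        using down_set_chain[of f, OF arcs f0] by blast
      then have "comp ?Y \<subseteq> comp {u. u \<preceq> f k}" for k
        using Y down[of k] by (intro end_component_subset wf_D' w) auto
      with u comp have "f (Suc k) \<preceq> u" for k by blast
      \<comment> \<open>Index 0 is left out because the bounds concern \<open>f (Suc k)\<close>. As
        \<open>f\<close> is injective, \<open>u\<close> would have infinitely many
        predecessors.\<close>
      then have "f ` {0<..} \<subseteq> {x. x \<preceq> u}" by (auto simp: greaterThan_0)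
      then have "finite (f ` {0<..})" using finite_down_set[OF u(2)] by (rule finite_subset)
      with inj have "finite {0::nat<..}" by (meson finite_imageD inj_on_subset subset_UNIV)
      then show False by (simp add: infinite_Ioi)
    qed
    then obtain j where j: "f j \<in> comp ?Y" by blast
    with disj have "\<not> f j \<preceq> f n" by blast
    then have "n < j" using chain_le[of f, OF arcs] by (meson not_le)
    moreover have "comp ?Y \<subseteq> comp X"
      using X Y disj by (intro end_component_subset wf_D' w) auto
    ultimately show ?thesis using j by blast
  qed
  have "has_tail_in f (end_component (with_proj D) X \<omega>)"
    if X: "finite X" "X \<subseteq> verts (with_proj D)" for X
  proof -
    note C = end_component_in_sccs[OF wf_D' w X]
    have "finite (f -` X)" using X(1) inj by (rule finite_vimageI)
    \<comment> \<open>Beyond \<open>n\<close> the ray has left \<open>X\<close> for good.\<close>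
    then have "\<exists>n. \<forall>i \<in> f -` X. i \<le> n" by (simp only: finite_nat_set_iff_bounded_le)
    then obtain n where n: "\<And>i. f i \<in> X \<Longrightarrow> i \<le> n" by blast
    obtain j where j: "n < j" "f j \<in> comp X" using often[of X n] X by auto
    have "f i \<in> comp X" if "j \<le> i" for i
    proof -
      \<comment> \<open>A later visit at \<open>l\<close> encloses \<open>f i\<close>: the ray runs
        from \<open>f j\<close> through \<open>f i\<close> to \<open>f l\<close> outside
        \<open>X\<close>, so the strong component absorbs \<open>f i\<close>.\<close>
      obtain l where l: "i < l" "f l \<in> comp X" using often[of X i] X by auto
      have "f m \<in> pverts D - X" if "j \<le> m" for m
        using n[of m] that j(1) fT pverts_sub by auto
      then have "(f j, f i) \<in> rtrancl_on (pverts D - X) (arcs_ends (with_proj D))"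
        "(f i, f l) \<in> rtrancl_on (pverts D - X) (arcs_ends (with_proj D))"
        using \<open>j \<le> i\<close> l(1) by (simp_all add: ray_reachable[OF ray_in_D[OF ray]] del: with_proj_simps)
      with sccs_minus_absorb[OF wf_D' C j(2) l(2)] show ?thesis by simp
    qed
    with wf_D' C ray_in_D[OF ray] show ?thesis by (rule has_tail_inI)
  qed
  with wf_D' w ray_in_D[OF ray] have "f \<in> \<omega>" by (rule in_end_if_tails)
  with ray f0 show ?thesis by (rule that)
qed

end

end

theorem theorem1:
  fixes D T :: "'a pair_pre_digraph" and U :: "'a set" and r :: 'a
  assumes "pair_loopfree_digraph D"
    and "U \<subseteq> pverts D"
    and "subgraph (with_proj T) (with_proj D)"
    and "arborescence T r"
    and "normal_in D T"
    and "U \<subseteq> pverts T"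
  shows "end_faithful T r {\<omega> \<in> ends (with_proj D). in_closure (with_proj D) \<omega> U}"
proof -
  interpret normal_arborescence T r D
    using assms
    by (simp add: normal_arborescence_def normal_arborescence_axioms_def
        rooted_arborescence_def pair_loopfree_digraph_def)
  show ?thesis
    unfolding end_faithful_def
  proof
    fix \<omega> assume "\<omega> \<in> {\<omega> \<in> ends (with_proj D). in_closure (with_proj D) \<omega> U}"
    then have w: "\<omega> \<in> ends (with_proj D)" "in_closure (with_proj D) \<omega> U" by simp_all
    obtain f where f: "ray (with_proj T) f" "f 0 = r" "f \<in> \<omega>"
      by (rule ray_in_closure_end[OF w assms(6)])
    show "\<exists>!f. ray (with_proj T) f \<and> f 0 = r \<and> f \<in> \<omega>"
    proof (rule ex1I[of _ f])
      fix g assume "ray (with_proj T) g \<and> g 0 = r \<and> g \<in> \<omega>"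
      then have "ray (with_proj T) g" "g 0 = r" "g \<in> \<omega>" by simp_all
      then show "g = f" using f by (rule rays_in_end_eq[OF w(1)])
    qed (use f in simp)
  qed
qed

end
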